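(* Let $k$ be a positive integer and let $K$ be an integer with $K>\frac{(k+1)(k+2)}{2}$. Then the minimum cost of a $k$-solvable natural test with exactly $K$ options is $$K+\frac{k(k+1)(k+2)}{3}.$$
   Context: A natural test is a finite multiset of positive integers (its answers, or options, counted with multiplicity; order is irrelevant). The cost of a test is the sum of all its answers with multiplicity, and the number of options is the number of answers counted with multiplicity. A positive integer $a$ is a valid answer of a natural test if $a$ appears in the test exactly $a$ times. A test is $k$-solvable if it has exactly $k$ distinct valid answers. *)

theory Defs
  imports Complex_Main "HOL-Library.Multiset"
begin

definition natural_test :: "nat multiset \<Rightarrow> bool" where
  "natural_test T \<longleftrightarrow> (\<forall>a \<in># T. 0 < a)"

definition cost :: "nat multiset \<Rightarrow> nat" where
  "cost T = sum_mset T"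

definition option_count :: "nat multiset \<Rightarrow> nat" where
  "option_count T = size T"

text \<open>Positivity is required explicitly: otherwise \<open>0\<close>, occurring zero times in any
  natural test, would count as a valid answer.\<close>

definition valid_answer :: "nat multiset \<Rightarrow> nat \<Rightarrow> bool" where
  "valid_answer T a \<longleftrightarrow> 0 < a \<and> count T a = a"

text \<open>The set of valid answers is contained in \<open>set_mset T\<close>, hence finite, so \<open>card\<close>
  really counts it.\<close>

definition solvable :: "nat \<Rightarrow> nat multiset \<Rightarrow> bool" where
  "solvable k T \<longleftrightarrow> card {a. valid_answer T a} = k"

definition is_minimum :: "'a::order \<Rightarrow> 'a set \<Rightarrow> bool" where
  "is_minimum m S \<longleftrightarrow> m \<in> S \<and> (\<forall>x \<in> S. m \<le> x)"

end

theory Submission imports Defs begin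

text \<open>
  For a test \<open>T\<close> with \<open>K\<close> options let \<open>V\<close> be its set of valid answers and \<open>m\<close> the
  least positive integer outside \<open>V\<close>; then \<open>1 \<le> m \<le> k + 1\<close>. The proof measures costs
  relative to this level: \<open>cost T - m * K\<close> is the sum of \<open>x - m\<close> over all options \<open>x\<close>.
  All of \<open>1, \<dots>, m - 1\<close> are valid, so the total negative contribution is known exactly. An
  option above \<open>m\<close> contributes positively, so discarding the invalid ones leaves a lower
  bound; hence \<open>cost T - m * K\<close> is at least the sum of \<open>a * (a - m)\<close> over \<open>V\<close>
  (\<open>cost_relative_to_level\<close>).

  The \<open>k - m + 1\<close> valid answers above \<open>m\<close> are at best \<open>m + 1, \<dots>, k + 1\<close>, and \<open>a = m\<close>
  contributes nothing, so \<open>V\<close> may be replaced by \<open>{1..k + 1}\<close>. Writing \<open>S\<close> for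
  \<open>1 + \<dots> + (k + 1)\<close> and \<open>Q\<close> for the sum of the corresponding squares, this says
  \<open>cost T \<ge> m * (K - S) + Q\<close>. As \<open>K \<ge> S\<close>, the worst case is \<open>m = 1\<close>, which gives
  \<open>K - S + Q\<close> (\<open>cost_ge\<close>), and \<open>Q - S = k (k + 1) (k + 2) / 3\<close>.

  The bound is attained by the answers \<open>2, \<dots>, k + 1\<close>, each valid, padded with ones
  (\<open>staircase\<close>). The strict inequality \<open>K > S\<close> makes the number of ones exceed \<open>1\<close>, so
  that the padding does not create a further valid answer.
\<close>

section \<open>Sums of squares and sums over the least available integers\<close>

lemma double_sum_upto: "2 * (\<Sum>a=1..Suc k. int a) = (int k + 1) * (int k + 2)"
  by (induction k) (simp_all add: algebra_simps)

lemma triple_sum_squares_minus_sum: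
  "3 * ((\<Sum>a=1..Suc k. int a * int a) - (\<Sum>a=1..Suc k. int a))
     = int k * (int k + 1) * (int k + 2)"
  by (induction k) (simp_all add: algebra_simps)

text \<open>The largest element of a set of \<open>n\<close> integers above \<open>m\<close> is at least \<open>m + n\<close>; removing
  it leaves the same situation with \<open>n - 1\<close> elements.\<close>

lemma sum_least_le_sum:
  fixes f :: "nat \<Rightarrow> 'b :: ordered_comm_monoid_add"
  assumes "finite W" and "W \<subseteq> {m<..}" and "mono_on {m<..} f"
  shows "sum f {m<..m + card W} \<le> sum f W"
  using assms(1,2)
proof (induction "card W" arbitrary: W)
  case 0
  then show ?case by simp
next
  case (Suc n)
  define M where "M = Max W"
  have "W \<noteq> {}"
    using Suc.hyps(2) by auto
  then have M: "M \<in> W" and W_le: "W \<subseteq> {m<..M}"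
    using Suc.prems by (auto simp: M_def)
  have "card W \<le> M - m"
    using card_mono[OF _ W_le] by simp
  then have "m + Suc n \<le> M"
    using Suc.hyps(2) by simp
  then have top: "f (m + Suc n) \<le> f M"
    using mono_onD[OF assms(3), of "m + Suc n" M] by simp
  have card_rest: "card (W - {M}) = n"
    using Suc.hyps(2) M Suc.prems(1) by simp
  have "{m<..m + card W} = insert (m + Suc n) {m<..m + n}"
    using Suc.hyps(2) by auto
  then have "sum f {m<..m + card W} = f (m + Suc n) + sum f {m<..m + n}"
    by simp
  also have "\<dots> \<le> f M + sum f (W - {M})"
    using Suc.hyps(1)[of "W - {M}"] Suc.prems top card_rest
    by (intro add_mono) auto
  also have "\<dots> = sum f W"
    using sum.remove[OF Suc.prems(1) M, of f] by simp
  finally show ?case .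
qed

section \<open>The lower bound\<close>

lemma finite_valid_answers: "finite {a. valid_answer T a}"
proof (rule finite_subset)
  show "{a. valid_answer T a} \<subseteq> set_mset T"
    by (auto simp: valid_answer_def simp flip: count_greater_zero_iff)
qed simp

lemma sum_count_mult_eq_sum_mset:
  fixes g :: "'a \<Rightarrow> 'b :: comm_semiring_1"
  assumes "finite A" and "set_mset T \<subseteq> A"
  shows "(\<Sum>a\<in>A. of_nat (count T a) * g a) = (\<Sum>a\<in>#T. g a)"
  using assms(2)
proof (induction T)
  case empty
  then show ?case by simp
next
  case (add x T)
  have "(\<Sum>a\<in>A. of_nat (count (add_mset x T) a) * g a)
      = (\<Sum>a\<in>A. (if a = x then g a else 0) + of_nat (count T a) * g a)"
    by (rule sum.cong) (auto simp: algebra_simps)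
  also have "\<dots> = g x + (\<Sum>a\<in>#T. g a)"
    using add assms(1) by (simp add: sum.distrib)
  finally show ?case by simp
qed

lemma sum_mset_minus_level:
  "(\<Sum>a\<in>#T. int a - int m) = int (sum_mset T) - int m * int (size T)"
  by (induction T) (simp_all add: algebra_simps)

text \<open>The options that are not valid answers all lie at or above the level \<open>m\<close> against which
  the cost is measured, so dropping them can only lower the sum.\<close>

lemma cost_relative_to_level:
  assumes "natural_test T" and low: "\<And>a. 0 < a \<Longrightarrow> a < m \<Longrightarrow> valid_answer T a"
  shows "(\<Sum>a | valid_answer T a. int a * (int a - int m))
           \<le> int (cost T) - int m * int (option_count T)"
proof -
  let ?V = "{a. valid_answer T a}"
  have "(\<Sum>a\<in>?V. int a * (int a - int m))
      = (\<Sum>a\<in>?V. int (count T a) * (int a - int m))"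
    by (rule sum.cong) (auto simp: valid_answer_def)
  also have "\<dots> \<le> (\<Sum>a\<in>set_mset T. int (count T a) * (int a - int m))"
  proof (rule sum_mono2)
    show "?V \<subseteq> set_mset T"
      by (auto simp: valid_answer_def simp flip: count_greater_zero_iff)
    fix a
    assume a: "a \<in> set_mset T - ?V"
    then have "0 < a"
      using assms(1) by (auto simp: natural_test_def)
    then have "m \<le> a"
      using low[of a] a by force
    then show "0 \<le> int (count T a) * (int a - int m)"
      by simp
  qed simp
  also have "\<dots> = int (cost T) - int m * int (option_count T)"
    using sum_count_mult_eq_sum_mset[of "set_mset T" T "\<lambda>a. int a - int m"]
    by (simp add: sum_mset_minus_level cost_def option_count_def)
  finally show ?thesis .
qed

lemma cost_ge:
  assumes "natural_test T" and "solvable k T"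
    and enough: "(\<Sum>a=1..Suc k. int a) \<le> int (option_count T)"
  shows "int (option_count T) + (\<Sum>a=1..Suc k. int a * int a) - (\<Sum>a=1..Suc k. int a)
           \<le> int (cost T)"
proof -
  let ?V = "{a. valid_answer T a}"
  have fin: "finite ?V"
    by (rule finite_valid_answers)
  have card_V: "card ?V = k"
    using assms(2) by (simp add: solvable_def)
  define m where "m = (LEAST a. 0 < a \<and> a \<notin> ?V)"
  have "\<exists>a. 0 < a \<and> a \<notin> ?V"
  proof -
    obtain a where "a \<notin> insert 0 ?V"
      using fin ex_new_if_finite[OF infinite_UNIV_nat, of "insert 0 ?V"] by auto
    then show ?thesis by auto
  qed
  then have m: "0 < m" "\<not> valid_answer T m"
    unfolding m_def by (metis (mono_tags, lifting) LeastI_ex mem_Collect_eq)+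
  have low: "valid_answer T a" if "0 < a" "a < m" for a
    using not_less_Least[of a "\<lambda>a. 0 < a \<and> a \<notin> ?V"] that by (simp add: m_def)
  define W where "W = ?V \<inter> {m<..}"
  define f where "f = (\<lambda>a. int a * (int a - int m))"
  have V_split: "?V = {1..<m} \<union> W"
    using low m by (auto simp: W_def valid_answer_def Suc_le_eq intro: linorder_cases[of _ m])
  have fin_W: "finite W"
    using fin by (simp add: W_def)
  have "card ?V = (m - 1) + card W"
    unfolding V_split using fin_W by (subst card_Un_disjoint) (auto simp: W_def)
  then have card_W: "m + card W = Suc k"
    using card_V m by simp
  have "mono_on {m<..} f"
    unfolding f_def by (intro mono_onI mult_mono) auto
  then have "sum f {m<..Suc k} \<le> sum f W"
    using sum_least_le_sum[OF fin_W, of m f] card_W by (simp add: W_def)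
  moreover have "sum f {1..Suc k} = sum f {1..<m} + sum f {m<..Suc k}"
  proof -
    have "{1..Suc k} = insert m ({1..<m} \<union> {m<..Suc k})"
      using m card_W by auto
    moreover have "f m = 0"
      by (simp add: f_def)
    ultimately show ?thesis
      by (simp add: sum.union_disjoint disjoint_iff)
  qed
  moreover have "sum f ?V = sum f {1..<m} + sum f W"
    unfolding V_split using fin_W by (subst sum.union_disjoint) (auto simp: W_def)
  moreover have "sum f ?V \<le> int (cost T) - int m * int (option_count T)"
    unfolding f_def by (rule cost_relative_to_level[OF assms(1)]) (rule low)
  ultimately have "sum f {1..Suc k} \<le> int (cost T) - int m * int (option_count T)"
    by linarith
  moreover have "sum f {1..Suc k}
      = (\<Sum>a=1..Suc k. int a * int a) - int m * (\<Sum>a=1..Suc k. int a)"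
    unfolding f_def sum_distrib_left sum_subtractf[symmetric]
    by (intro sum.cong) (auto simp: algebra_simps)
  \<comment> \<open>The surplus of options over the sum is nonnegative, so the level can be lowered to 1.\<close>
  moreover have "1 * (int (option_count T) - (\<Sum>a=1..Suc k. int a))
      \<le> int m * (int (option_count T) - (\<Sum>a=1..Suc k. int a))"
    using m enough by (intro mult_right_mono) auto
  ultimately show ?thesis
    by (simp only: right_diff_distrib mult_1)
qed

section \<open>Attaining the bound\<close>

definition staircase :: "nat \<Rightarrow> nat \<Rightarrow> nat multiset" where
  "staircase r k = replicate_mset r 1 + (\<Sum>a=2..Suc k. replicate_mset a a)"

lemma staircase_0: "staircase r 0 = replicate_mset r 1"
  by (simp add: staircase_def)

lemma staircase_Suc:
  "staircase r (Suc k) = staircase r k + replicate_mset (Suc (Suc k)) (Suc (Suc k))"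
  by (simp add: staircase_def del: replicate_mset_Suc)

lemmas staircase_simps = staircase_0 staircase_Suc

lemma count_staircase:
  "count (staircase r k) a = (if a = 1 then r else if a \<in> {2..Suc k} then a else 0)"
  by (induction k) (auto simp: staircase_simps simp del: replicate_mset_Suc)

lemma size_staircase:
  "int (size (staircase r k)) = int r + (\<Sum>a=1..Suc k. int a) - 1"
  by (induction k) (simp_all add: staircase_simps del: replicate_mset_Suc)

lemma sum_mset_staircase:
  "int (sum_mset (staircase r k)) = int r + (\<Sum>a=1..Suc k. int a * int a) - 1"
  by (induction k) (simp_all add: staircase_simps sum_mset_replicate_mset algebra_simps
      del: replicate_mset_Suc)

lemma natural_test_staircase: "natural_test (staircase r k)"
  by (auto simp: natural_test_def count_staircase simp flip: count_greater_zero_iff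
      split: if_splits)

text \<open>With \<open>r = 1\<close> the answer \<open>1\<close> would be valid as well.\<close>

lemma solvable_staircase:
  assumes "r \<noteq> 1"
  shows "solvable k (staircase r k)"
proof -
  have "{a. valid_answer (staircase r k) a} = {2..Suc k}"
    using assms by (auto simp: valid_answer_def count_staircase split: if_splits)
  then show ?thesis
    by (simp add: solvable_def)
qed

section \<open>The minimum cost\<close>

theorem theorem7:
  fixes k :: nat and K :: int
  assumes "k > 0"
    and "real_of_int K > (real k + 1) * (real k + 2) / 2"
  shows "is_minimum (real_of_int K + real k * (real k + 1) * (real k + 2) / 3)
    {real (cost T) | T. natural_test T \<and> solvable k T \<and> int (option_count T) = K}"
proof -
  define S where "S = (\<Sum>a=1..Suc k. int a)"
  define Q where "Q = (\<Sum>a=1..Suc k. int a * int a)"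
  have "real_of_int (2 * S) = (real k + 1) * (real k + 2)"
    unfolding S_def double_sum_upto by simp
  then have K: "S < K"
    using assms(2) by simp
  have "real_of_int (3 * (Q - S)) = real k * (real k + 1) * (real k + 2)"
    unfolding S_def Q_def triple_sum_squares_minus_sum by simp
  then have value_eq:
    "real_of_int K + real k * (real k + 1) * (real k + 2) / 3 = real_of_int (K + Q - S)"
    by simp
  show ?thesis
    unfolding is_minimum_def value_eq
  proof (intro conjI ballI)
    \<comment> \<open>The steps 2 to k + 1 use S - 1 options, which leaves K - S + 1 ones.\<close>
    define T where "T = staircase (nat (K - S + 1)) k"
    have "natural_test T" and "solvable k T"
      using K by (auto simp: T_def intro!: natural_test_staircase solvable_staircase)
    moreover have "int (option_count T) = K"
      using K by (simp only: T_def option_count_def size_staircase flip: S_def)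
    moreover have "int (cost T) = K + Q - S"
      using K by (simp only: T_def cost_def sum_mset_staircase flip: Q_def)
    then have "real_of_int (K + Q - S) = real (cost T)"
      by (metis of_int_of_nat_eq)
    ultimately show "real_of_int (K + Q - S)
        \<in> {real (cost T) | T. natural_test T \<and> solvable k T \<and> int (option_count T) = K}"
      by blast
  next
    fix x
    assume "x \<in> {real (cost T) | T.
      natural_test T \<and> solvable k T \<and> int (option_count T) = K}"
    then obtain T where T: "x = real (cost T)" "natural_test T" "solvable k T"
      "int (option_count T) = K"
      by auto
    have "K + Q - S \<le> int (cost T)"
      using cost_ge[OF T(2,3)] T(4) K unfolding S_def Q_def by simp
    then have "real_of_int (K + Q - S) \<le> real_of_int (int (cost T))"
      by (simp only: of_int_le_iff)
    then show "real_of_int (K + Q - S) \<le> x"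
      by (simp add: T(1))
  qed
qed

end
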